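(* Let $P$ be a finite poset and $A$ its set of minimal elements. Then for every nonnegative integer $m$, $$e(m,P)=\sum_{B\subseteq A}(-1)^{|B|}\, d(P-B)^m .$$
   Context: For a finite poset $P$ on a set $K$ and a finite set $M$ disjoint from $K$ with $|M|=m$, $e(m,P)$ is the number of partial orders on $M\cup K$ that induce $P$ on $K$ and whose set of minimal elements is exactly $M$ (this depends only on $m$). $d(\cdot)$ denotes the number of downsets of a finite poset (the empty poset has one), and $P-B$ is the subposet induced on $K\setminus B$. Convention $x^0=1$. *)

theory Defs
  imports Main
begin

text \<open>
  A poset on \<open>K\<close> is a reflexive order relation \<open>P\<close> with
  \<^term>\<open>partial_order_on K P\<close>; a pair \<open>(x, y) \<in> P\<close> means \<open>x \<le> y\<close>.
\<close>

definition minimal_elements :: "'a set \<Rightarrow> 'a rel \<Rightarrow> 'a set" where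
  "minimal_elements K P = {x \<in> K. \<forall>y\<in>K. (y, x) \<in> P \<longrightarrow> y = x}"

definition induced_order :: "'a rel \<Rightarrow> 'a set \<Rightarrow> 'a rel" where
  "induced_order P S = P \<inter> (S \<times> S)"

definition downsets :: "'a set \<Rightarrow> 'a rel \<Rightarrow> 'a set set" where
  "downsets K P = {D. D \<subseteq> K \<and> (\<forall>x\<in>D. \<forall>y\<in>K. (y, x) \<in> P \<longrightarrow> y \<in> D)}"

definition num_downsets :: "'a set \<Rightarrow> 'a rel \<Rightarrow> nat" where
  "num_downsets K P = card (downsets K P)"

text \<open>
  The number \<open>e(m, P)\<close>, computed with a concrete set \<open>M\<close> of \<open>m\<close> elements,
  which is meant to be finite and disjoint from \<open>K\<close>.
\<close>

definition num_min_extensions :: "'a set \<Rightarrow> 'a set \<Rightarrow> 'a rel \<Rightarrow> nat" where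
  "num_min_extensions M K P =
     card {Q. partial_order_on (M \<union> K) Q \<and> induced_order Q K = P \<and>
              minimal_elements (M \<union> K) Q = M}"

end

theory Submission
  imports Defs "HOL-Library.FuncSet"
begin

text \<open>
  An order counted by \<open>e(m, P)\<close> is determined by the sets \<open>D x = {k \<in> K. \<not> x \<le> k}\<close>, for
  \<open>x \<in> M\<close>. These are arbitrary downsets of \<open>P\<close>, subject only to the condition that no
  minimal element of \<open>P\<close> lies in all of them, which is what keeps it from being minimal
  in the extension. Inclusion-exclusion over the set \<open>B\<close> of minimal elements lying in all
  the \<open>D x\<close> gives the formula, because removing \<open>B\<close> is a bijection from the downsets of \<open>P\<close>
  containing \<open>B\<close> to the downsets of \<open>P - B\<close>.
\<close>

text \<open>Expanding the product of \<open>- 1 + 1\<close> over \<open>S\<close> gives this sum, so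
  it equals \<open>0 ^ card S\<close>.\<close>

lemma sum_Pow_neg_one_power_card:
  assumes "finite S"
  shows "(\<Sum>B\<in>Pow S. (- 1) ^ card B) = (if S = {} then 1 else 0 :: 'a::comm_ring_1)"
  using prod_add[OF assms, of "\<lambda>_. - 1 :: 'a" "\<lambda>_. 1"] assms
  by (simp add: power_0_left flip: card_0_eq)

lemma finite_downsets: "finite K \<Longrightarrow> finite (downsets K P)"
  by (rule finite_subset[of _ "Pow K"]) (auto simp: downsets_def)

lemma card_downsets_containing_minimal:
  assumes "B \<subseteq> minimal_elements K P"
  shows "card {D \<in> downsets K P. B \<subseteq> D} = num_downsets (K - B) (induced_order P (K - B))"
  unfolding num_downsets_def
proof (rule bij_betw_same_card,
    rule bij_betw_byWitness[where f = "\<lambda>D. D - B" and f' = "\<lambda>D. D \<union> B"])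
  show "\<forall>D\<in>{D \<in> downsets K P. B \<subseteq> D}. (D - B) \<union> B = D"
    by auto
  show "\<forall>D\<in>downsets (K - B) (induced_order P (K - B)). (D \<union> B) - B = D"
    by (auto simp: downsets_def)
  show "(\<lambda>D. D - B) ` {D \<in> downsets K P. B \<subseteq> D}
      \<subseteq> downsets (K - B) (induced_order P (K - B))"
    by (auto simp: downsets_def induced_order_def)
  show "(\<lambda>D. D \<union> B) ` downsets (K - B) (induced_order P (K - B))
      \<subseteq> {D \<in> downsets K P. B \<subseteq> D}"
    \<comment> \<open>Minimality of \<open>B\<close> enters here: its elements have nothing strictly
      below them, so adding them to \<open>D\<close> keeps it closed downwards.\<close>
    using assms by (auto simp: downsets_def induced_order_def minimal_elements_def)
qed

definition extension_of :: "'a set \<Rightarrow> 'a set \<Rightarrow> 'a rel \<Rightarrow> ('a \<Rightarrow> 'a set) \<Rightarrow> 'a rel" where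
  "extension_of M K P f = P \<union> Id_on M \<union> {(x, k). x \<in> M \<and> k \<in> K - f x}"

text \<open>The extensional function space fixes the values outside \<open>M\<close>, so distinct
  families give distinct orders.\<close>

definition downset_families :: "'a set \<Rightarrow> 'a set \<Rightarrow> 'a rel \<Rightarrow> ('a \<Rightarrow> 'a set) set" where
  "downset_families M K P =
     {f \<in> M \<rightarrow>\<^sub>E downsets K P. \<forall>a\<in>minimal_elements K P. \<exists>x\<in>M. a \<notin> f x}"

lemma extension_of_partial_order_on:
  assumes P: "partial_order_on K P" and disj: "M \<inter> K = {}"
    and f: "\<And>x. x \<in> M \<Longrightarrow> f x \<in> downsets K P"
  shows "partial_order_on (M \<union> K) (extension_of M K P f)"
proof -
  note P' = partial_order_onD[OF P]
  have "extension_of M K P f \<subseteq> (M \<union> K) \<times> (M \<union> K)"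
    using P'(4) by (auto simp: extension_of_def)
  moreover have "refl_on (M \<union> K) (extension_of M K P f)"
    using P'(1) by (auto simp: extension_of_def refl_on_def)
  moreover have "trans (extension_of M K P f)"
  proof (rule transI)
    fix x y z
    assume xy: "(x, y) \<in> extension_of M K P f" and yz: "(y, z) \<in> extension_of M K P f"
    show "(x, z) \<in> extension_of M K P f"
    \<comment> \<open>This is the only case needing the downset property: \<open>z\<close> in
      \<open>f x\<close> would force the smaller \<open>y\<close> into \<open>f x\<close>. Otherwise
      \<open>x = y\<close> lies in \<open>M\<close> or all three points lie in
      \<open>K\<close>.\<close>
    proof (cases "x \<in> M \<and> y \<in> K \<and> z \<in> K")
      case True
      then have "y \<notin> f x" "(y, z) \<in> P"
        using xy yz P'(4) disj by (auto simp: extension_of_def)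
      then have "z \<notin> f x"
        using f[of x] True by (auto simp: downsets_def)
      with True show ?thesis
        by (auto simp: extension_of_def)
    next
      case False
      then show ?thesis
        using xy yz P'(4) disj transD[OF P'(2), of x y z]
        by (auto simp: extension_of_def)
    qed
  qed
  moreover have "antisym (extension_of M K P f)"
    using P'(4) disj antisymD[OF P'(3)]
    by (intro antisymI) (auto simp: extension_of_def)
  ultimately show ?thesis
    by (simp add: partial_order_on_def preorder_on_def)
qed

text \<open>Only reflexive pairs end in \<open>M\<close>, so \<open>M\<close> stays minimal. A
  minimal element of the extension outside \<open>M\<close> would be minimal in \<open>P\<close>,
  but then some \<open>x\<close> in \<open>M\<close> was placed below it.\<close>

lemma minimal_elements_extension_of:
  assumes P: "partial_order_on K P" and disj: "M \<inter> K = {}"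
    and f: "\<forall>a\<in>minimal_elements K P. \<exists>x\<in>M. a \<notin> f x"
  shows "minimal_elements (M \<union> K) (extension_of M K P f) = M"
proof
  have PK: "P \<subseteq> K \<times> K"
    using partial_order_onD(4)[OF P] .
  show "M \<subseteq> minimal_elements (M \<union> K) (extension_of M K P f)"
    using PK disj by (auto simp: minimal_elements_def extension_of_def)
  show "minimal_elements (M \<union> K) (extension_of M K P f) \<subseteq> M"
  proof (rule subsetI, rule ccontr)
    fix k
    assume k: "k \<in> minimal_elements (M \<union> K) (extension_of M K P f)" and "k \<notin> M"
    then have "k \<in> minimal_elements K P"
      by (auto simp: minimal_elements_def extension_of_def)
    moreover from this obtain x where "x \<in> M" "k \<notin> f x"
      using f by blast
    ultimately have "(x, k) \<in> extension_of M K P f"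
      by (auto simp: minimal_elements_def extension_of_def)
    with k \<open>x \<in> M\<close> \<open>k \<notin> M\<close> show False
      by (auto simp: minimal_elements_def)
  qed
qed

lemma bij_betw_extension_of:
  assumes P: "partial_order_on K P" and disj: "M \<inter> K = {}"
  shows "bij_betw (extension_of M K P) (downset_families M K P)
    {Q. partial_order_on (M \<union> K) Q \<and> induced_order Q K = P \<and> minimal_elements (M \<union> K) Q = M}"
    (is "bij_betw _ _ ?E")
proof (rule bij_betw_byWitness)
  have PK: "P \<subseteq> K \<times> K"
    using partial_order_onD(4)[OF P] .
  \<comment> \<open>The inverse map reads off which elements of \<open>K\<close> are not above
    \<open>x\<close>; it is restricted to \<open>M\<close> to land in the extensional function
    space.\<close>
  let ?g = "\<lambda>Q. \<lambda>x\<in>M. {k \<in> K. (x, k) \<notin> Q}"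
  show "\<forall>f\<in>downset_families M K P. ?g (extension_of M K P f) = f"
  proof
    fix f
    assume "f \<in> downset_families M K P"
    then have f: "f \<in> M \<rightarrow>\<^sub>E downsets K P"
      by (simp add: downset_families_def)
    show "?g (extension_of M K P f) = f"
    proof
      fix x
      show "?g (extension_of M K P f) x = f x"
      proof (cases "x \<in> M")
        case True
        then have "f x \<subseteq> K"
          using f by (auto simp: downsets_def)
        with True show ?thesis
          using PK disj by (auto simp: extension_of_def)
      next
        case False
        then show ?thesis
          using f by (auto simp: PiE_def extensional_def)
      qed
    qed
  qed
  show "\<forall>Q\<in>?E. extension_of M K P (?g Q) = Q"
  proof
    fix Q
    assume "Q \<in> ?E"
    then have Q: "partial_order_on (M \<union> K) Q" and ind: "Q \<inter> K \<times> K = P"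
      and min: "minimal_elements (M \<union> K) Q = M"
      by (auto simp: induced_order_def)
    \<comment> \<open>Since nothing lies strictly below \<open>M\<close>, each pair of
      \<open>Q\<close> is in \<open>P\<close>, on the diagonal of \<open>M\<close>, or goes from
      \<open>M\<close> to \<open>K\<close>: the three parts of \<open>extension_of\<close>.\<close>
    have min': "x = y" if "(x, y) \<in> Q" "y \<in> M" for x y
    proof -
      have "y \<in> minimal_elements (M \<union> K) Q"
        using min that by simp
      then show ?thesis
        using that partial_order_onD(4)[OF Q] by (auto simp: minimal_elements_def)
    qed
    have "Q \<subseteq> extension_of M K P (?g Q)"
      using partial_order_onD(4)[OF Q] ind min' by (auto simp: extension_of_def)
    moreover have "extension_of M K P (?g Q) \<subseteq> Q"
      using partial_order_onD(1)[OF Q] ind by (auto simp: extension_of_def refl_on_def)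
    ultimately show "extension_of M K P (?g Q) = Q"
      by blast
  qed
  show "extension_of M K P ` downset_families M K P \<subseteq> ?E"
  proof (rule image_subsetI)
    fix f
    assume "f \<in> downset_families M K P"
    then have "\<And>x. x \<in> M \<Longrightarrow> f x \<in> downsets K P"
      and "\<forall>a\<in>minimal_elements K P. \<exists>x\<in>M. a \<notin> f x"
      by (auto simp: downset_families_def)
    moreover have "induced_order (extension_of M K P f) K = P"
      using PK disj by (auto simp: induced_order_def extension_of_def)
    ultimately show "extension_of M K P f \<in> ?E"
      using extension_of_partial_order_on[OF P disj] minimal_elements_extension_of[OF P disj]
      by blast
  qed
  show "?g ` ?E \<subseteq> downset_families M K P"
  proof (rule image_subsetI)
    fix Q
    assume "Q \<in> ?E"
    then have Q: "partial_order_on (M \<union> K) Q" and ind: "P = Q \<inter> K \<times> K"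
      and min: "minimal_elements (M \<union> K) Q = M"
      by (auto simp: induced_order_def)
    have "?g Q x \<in> downsets K P" if "x \<in> M" for x
      using that ind transD[OF partial_order_onD(2)[OF Q]] by (auto simp: downsets_def)
    moreover have "\<exists>x\<in>M. a \<notin> ?g Q x" if a: "a \<in> minimal_elements K P" for a
    proof -
      have "a \<in> K"
        using a by (simp add: minimal_elements_def)
      then have "a \<notin> minimal_elements (M \<union> K) Q"
        using min disj by auto
      then obtain y where y: "y \<in> M \<union> K" "(y, a) \<in> Q" "y \<noteq> a"
        using \<open>a \<in> K\<close> by (auto simp: minimal_elements_def)
      \<comment> \<open>If \<open>y\<close> were in \<open>K\<close>, then \<open>(y, a)\<close>
        would be in \<open>P\<close>, against the minimality of \<open>a\<close> in
        \<open>P\<close>.\<close>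
      then have "y \<in> M"
        using a ind by (auto simp: minimal_elements_def)
      with y show ?thesis
        by auto
    qed
    ultimately show "?g Q \<in> downset_families M K P"
      by (auto simp: downset_families_def)
  qed
qed

lemma card_downset_families:
  assumes "finite K" and "finite M"
  shows "int (card (downset_families M K P)) =
    (\<Sum>B \<in> Pow (minimal_elements K P).
       (- 1) ^ card B * int (card {D \<in> downsets K P. B \<subseteq> D}) ^ card M)"
proof -
  let ?A = "minimal_elements K P" and ?F = "M \<rightarrow>\<^sub>E downsets K P"
  \<comment> \<open>\<open>S f\<close> collects the violations of the covering condition:
    \<open>f\<close> is an admissible family iff \<open>S f\<close> is empty. For empty
    \<open>M\<close> it is all of \<open>?A\<close>.\<close>
  define S where "S f = {a \<in> ?A. \<forall>x\<in>M. a \<in> f x}" for f :: "'a \<Rightarrow> 'a set"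
  have finA: "finite ?A"
    using assms(1) by (simp add: minimal_elements_def)
  have finF: "finite ?F"
    using assms finite_downsets by (intro finite_PiE) auto
  have "int (card (downset_families M K P)) = (\<Sum>f\<in>?F. if S f = {} then 1 else 0)"
    using finF by (auto simp: downset_families_def S_def sum.If_cases Int_def
        intro!: arg_cong[where f = card])
  also have "\<dots> = (\<Sum>f\<in>?F. \<Sum>B\<in>Pow (S f). (- 1) ^ card B)"
    using finA by (intro sum.cong refl sum_Pow_neg_one_power_card[symmetric]) (simp add: S_def)
  \<comment> \<open>Padding with zeros makes the inner range independent of \<open>f\<close>, so
    that the sums can be swapped.\<close>
  also have "\<dots> = (\<Sum>f\<in>?F. \<Sum>B\<in>Pow ?A. if B \<subseteq> S f then (- 1) ^ card B else 0)"
    using finA by (intro sum.cong refl sum.mono_neutral_cong_left) (auto simp: S_def)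
  also have "\<dots> = (\<Sum>B\<in>Pow ?A. \<Sum>f\<in>?F. if B \<subseteq> S f then (- 1) ^ card B else 0)"
    by (rule sum.swap)
  also have "\<dots> = (\<Sum>B\<in>Pow ?A. (- 1) ^ card B * int (card {f \<in> ?F. B \<subseteq> S f}))"
    using finF by (simp add: sum.If_cases Int_def mult.commute)
  also have "\<dots> = (\<Sum>B\<in>Pow ?A. (- 1) ^ card B * int (card {D \<in> downsets K P. B \<subseteq> D}) ^ card M)"
  proof (intro sum.cong refl)
    fix B
    assume "B \<in> Pow ?A"
    \<comment> \<open>\<open>B\<close> lies in \<open>S f\<close> iff every value of
      \<open>f\<close> contains \<open>B\<close>, so the values are chosen independently and a power
      with exponent \<open>card M\<close> results.\<close>
    then have "{f \<in> ?F. B \<subseteq> S f} = M \<rightarrow>\<^sub>E {D \<in> downsets K P. B \<subseteq> D}"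
      by (auto simp: S_def PiE_def Pi_def)
    then show "(- 1) ^ card B * int (card {f \<in> ?F. B \<subseteq> S f}) =
        (- 1) ^ card B * int (card {D \<in> downsets K P. B \<subseteq> D}) ^ card M"
      using assms(2) by (simp add: card_funcsetE)
  qed
  finally show ?thesis .
qed

theorem theorem4p2:
  fixes K M :: "'a set" and P :: "'a rel" and m :: nat
  assumes "finite K" and "partial_order_on K P"
    and "finite M" and "M \<inter> K = {}" and "card M = m"
  shows "int (num_min_extensions M K P) =
    (\<Sum>B \<in> Pow (minimal_elements K P).
       (- 1) ^ card B * int (num_downsets (K - B) (induced_order P (K - B))) ^ m)"
proof -
  have "num_min_extensions M K P = card (downset_families M K P)"
    unfolding num_min_extensions_def
    using bij_betw_same_card[OF bij_betw_extension_of[OF assms(2,4)]] by simp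
  then show ?thesis
    using card_downset_families[OF assms(1,3), of P] assms(5)
    by (simp add: card_downsets_containing_minimal)
qed

end
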